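(* Let $g(z)=az^4+bz^3+cz^2+dz+e$ be a quartic polynomial with real coefficients and $a>0$, $e>0$. Let $$\alpha=b\,a^{-3/4}e^{-1/4},\quad \beta=c\,a^{-1/2}e^{-1/2},\quad \gamma=d\,a^{-1/4}e^{-3/4},$$ $$f(t)=t^4+\alpha t^3+\beta t^2+\gamma t+1,$$ $$\Delta(f)=4[\beta^2-3\alpha\gamma+12]^3-[72\beta+9\alpha\beta\gamma-2\beta^3-27\alpha^2-27\gamma^2]^2.$$ Then $f(t)\ge 0$ for all $t>0$ if and only if at least one of the following holds: (A) $\Delta(f)\le 0$ and $\alpha+\gamma>0$; (B) $\alpha\ge 0$, $\gamma\ge 0$ and $\beta\ge -2$; (C) $\Delta(f)\ge 0$, $|\alpha-\gamma|\le 4\sqrt{\beta+2}$, and either (i) $-2\le\beta\le 6$, or (ii) $\beta>6$ and $\alpha+\gamma\ge -4\sqrt{\beta-2}$.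
   Context: $\Delta(f)$, as given by the displayed formula, is (up to a positive constant factor) the discriminant of $f$. In (C), the condition involving $\sqrt{\beta+2}$ is only considered together with (i) or (ii), so that $\beta\ge -2$. *)

theory Defs
  imports "HOL-Analysis.Analysis" "HOL-Computational_Algebra.Polynomial"
begin

(* Meant for monic quartics t^4 + \<alpha> t^3 + \<beta> t^2 + \<gamma> t + 1, on which it equals
   27 times the discriminant. *)
definition Delta :: "real poly \<Rightarrow> real" where
  "Delta f =
    (let \<alpha> = coeff f 3; \<beta> = coeff f 2; \<gamma> = coeff f 1 in
       4 * (\<beta>^2 - 3 * \<alpha> * \<gamma> + 12)^3
       - (72 * \<beta> + 9 * \<alpha> * \<beta> * \<gamma> - 2 * \<beta>^3 - 27 * \<alpha>^2 - 27 * \<gamma>^2)^2)"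

end

theory Submission
  imports Defs
begin

text \<open>
  The quartic splits as \<open>(t\<^sup>2 + m P t + m\<^sup>2) (t\<^sup>2 + n R t + n\<^sup>2)\<close> with \<open>m, n > 0\<close> and \<open>m n = 1\<close>:
  pairing positive roots with positive roots keeps both constant terms positive. A factor
  takes a negative value at some \<open>t > 0\<close> iff its parameter \<open>P\<close> or \<open>R\<close> is below \<open>-2\<close>, so the quartic is
  nonnegative there iff \<open>P, R \<ge> -2\<close> or the two factors coincide. In these coordinates
  \<open>\<Delta> = 27 (P\<^sup>2 - 4) (R\<^sup>2 - 4) \<rho>\<^sup>2\<close>, where \<open>\<rho>\<close> is the resultant of the factors, and
  \<open>\<alpha> + \<gamma> = (m + n) (P + R)\<close>, \<open>\<alpha> - \<gamma> = (m - n) (P - R)\<close>, \<open>\<beta> = P R + m\<^sup>2 + n\<^sup>2\<close>,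
  which turns (A) and (C) into elementary inequalities for \<open>P\<close>, \<open>R\<close> and \<open>(m + n)\<^sup>2 \<ge> 4\<close>.
\<close>

section \<open>Factorization of the quartic\<close>

text \<open>Cubic resolvent in \<open>w = (m + n)\<^sup>2\<close>: substituting
  \<open>P + R = x / sqrt w\<close> and \<open>P - R = y / sqrt (w - 4)\<close> into
  \<open>P * R = \<beta> + 2 - w\<close> and clearing denominators gives this equation. At
  \<open>w = 4\<close> the left side is \<open>-4 * y\<^sup>2\<close>, so a sign change above 4
  yields a root.\<close>

lemma resolvent_root:
  fixes \<beta> x y :: real
  assumes "y \<noteq> 0"
  obtains w where "w > 4" and "x\<^sup>2 * (w - 4) - y\<^sup>2 * w + 4 * (w - \<beta> - 2) * w * (w - 4) = 0"
proof -
  define H where "H w = x\<^sup>2 * (w - 4) - y\<^sup>2 * w + 4 * (w - \<beta> - 2) * w * (w - 4)" for w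
  \<comment> \<open>Chosen so that \<open>K >= 1\<close> and \<open>4 * (K + 2 - \<beta>)\<close> is
    at least \<open>y\<^sup>2\<close>, which makes \<open>H (4 + K)\<close> nonnegative.\<close>
  define K where "K = \<bar>\<beta>\<bar> + y\<^sup>2 + 1"
  have K: "K \<ge> 1" by (simp add: K_def)
  have H4: "H 4 < 0" using assms by (simp add: H_def)
  have "1 * y\<^sup>2 \<le> K * (4 * (K + 2 - \<beta>))"
    by (rule mult_mono) (use K in \<open>auto simp: K_def\<close>)
  then have "y\<^sup>2 * (4 + K) \<le> K * (4 * (K + 2 - \<beta>)) * (4 + K)"
    using K by (intro mult_right_mono) auto
  moreover have "x\<^sup>2 * K \<ge> 0" using K by simp
  ultimately have HK: "H (4 + K) \<ge> 0" by (simp add: H_def algebra_simps)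
  have "\<exists>w\<ge>4. w \<le> 4 + K \<and> H w = 0"
    by (rule IVT') (use H4 HK K in \<open>auto simp: H_def intro!: continuous_intros\<close>)
  then obtain w where "w \<ge> 4" "H w = 0" by blast
  with H4 have "w > 4" by (cases "w = 4") auto
  with \<open>H w = 0\<close> that show ?thesis by (simp add: H_def)
qed

text \<open>Here \<open>x\<close>, \<open>y\<close>, \<open>M\<close>, \<open>N\<close> stand for
  \<open>\<alpha> + \<gamma>\<close>, \<open>\<alpha> - \<gamma>\<close>, \<open>m + n\<close>,
  \<open>m - n\<close>. For \<open>y\<close> nonzero the resolvent root allows division by
  \<open>N\<close>. For \<open>y = 0\<close> one takes either \<open>N = 0\<close> or
  \<open>P = R\<close>, whichever has a real solution.\<close>

lemma parameters_exist:
  fixes \<beta> x y :: real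
  obtains M N P R where "M > 0" "M\<^sup>2 - N\<^sup>2 = 4" "x = M * (P + R)" "y = N * (P - R)"
    "\<beta> + 2 = P * R + M\<^sup>2"
proof -
  consider (diff) "y \<noteq> 0" | (same) "y = 0" "x\<^sup>2 \<ge> 16 * (\<beta> - 2)" | (sym) "y = 0" "x\<^sup>2 < 16 * (\<beta> - 2)"
    by linarith
  then show ?thesis
  proof cases
    case diff
    then obtain w where w: "w > 4"
      and H: "x\<^sup>2 * (w - 4) - y\<^sup>2 * w + 4 * (w - \<beta> - 2) * w * (w - 4) = 0"
      by (rule resolvent_root)
    define M N where "M = sqrt w" and "N = sqrt (w - 4)"
    have MN: "M > 0" "N > 0" "M\<^sup>2 = w" "N\<^sup>2 = w - 4" using w by (auto simp: M_def N_def)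
    define P R where "P = (x / M + y / N) / 2" and "R = (x / M - y / N) / 2"
    have "P * R = ((x / M)\<^sup>2 - (y / N)\<^sup>2) / 4"
      by (simp add: P_def R_def power2_eq_square algebra_simps)
    also have "\<dots> = (x\<^sup>2 / w - y\<^sup>2 / (w - 4)) / 4"
      by (simp add: power_divide MN)
    also have "\<dots> = \<beta> + 2 - w"
      using w H by (simp add: field_simps)
    finally have "\<beta> + 2 = P * R + M\<^sup>2" by (simp add: MN)
    moreover have "x = M * (P + R)" "y = N * (P - R)"
      using MN(1,2) by (simp_all add: P_def R_def flip: add_divide_distrib diff_divide_distrib)
    ultimately show ?thesis using MN by (intro that[of M N P R]) auto
  next
    case same
    \<comment> \<open>With \<open>M = 2\<close>, \<open>N = 0\<close>, the parameters must have sum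
      \<open>x / 2\<close> and product \<open>\<beta> - 2\<close>; \<open>r / 2\<close> is the
      difference of the roots of that quadratic.\<close>
    define r where "r = sqrt (x\<^sup>2 - 16 * (\<beta> - 2))"
    have r: "r\<^sup>2 = x\<^sup>2 - 16 * (\<beta> - 2)" using same by (simp add: r_def)
    show ?thesis
      by (rule that[of 2 0 "(x + r) / 4" "(x - r) / 4"])
        (use same r in \<open>auto simp: field_simps power2_eq_square\<close>)
  next
    case sym
    define r where "r = sqrt ((\<beta> + 2)\<^sup>2 - x\<^sup>2)"
    have "0 \<le> (\<beta> - 6)\<^sup>2" by simp
    also have "\<dots> = (\<beta> + 2)\<^sup>2 - 16 * (\<beta> - 2)" by (simp add: power2_eq_square algebra_simps)
    finally have r: "r\<^sup>2 = (\<beta> + 2)\<^sup>2 - x\<^sup>2" "r \<ge> 0" "\<bar>\<beta> - 6\<bar> \<le> r"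
      using sym by (auto simp: r_def intro!: real_le_rsqrt simp: power2_eq_square algebra_simps)
    \<comment> \<open>With \<open>P = R = x / (2 * M)\<close> the remaining condition is
      \<open>w\<^sup>2 - (\<beta> + 2) * w + x\<^sup>2 / 4 = 0\<close>. The larger root is at least
      4 because \<open>r\<close> is at least \<open>6 - \<beta>\<close>, so
      \<open>sqrt (w - 4)\<close> makes sense.\<close>
    define w where "w = (\<beta> + 2 + r) / 2"
    have w: "w \<ge> 4" using r by (simp add: w_def)
    have q: "x\<^sup>2 / (4 * w) = \<beta> + 2 - w"
      using w r(1) unfolding w_def by (simp add: field_simps power2_eq_square)
    define M N where "M = sqrt w" and "N = sqrt (w - 4)"
    have MN: "M > 0" "M\<^sup>2 = w" "N\<^sup>2 = w - 4" using w by (auto simp: M_def N_def)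
    have "(x / (2 * M)) * (x / (2 * M)) = x\<^sup>2 / (4 * w)"
      using MN(1) unfolding MN(2)[symmetric] by (simp add: field_simps power2_eq_square)
    with q show ?thesis
      using sym MN by (intro that[of M N "x / (2 * M)" "x / (2 * M)"]) auto
  qed
qed

text \<open>Undoes the sum and difference coordinates: \<open>M\<^sup>2 - N\<^sup>2 = 4\<close>
  becomes \<open>m * n = 1\<close>, and it forces \<open>|N| < M\<close>, so both \<open>m\<close>
  and \<open>n\<close> are positive.\<close>

lemma quartic_parameters:
  fixes \<alpha> \<beta> \<gamma> :: real
  obtains m n P R where "m > 0" "n > 0" "m * n = 1"
    "\<alpha> = m * P + n * R" "\<gamma> = n * P + m * R" "\<beta> = P * R + m\<^sup>2 + n\<^sup>2"
proof -
  obtain M N P R where MN: "M > 0" "M\<^sup>2 - N\<^sup>2 = 4"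
    and x: "\<alpha> + \<gamma> = M * (P + R)" and y: "\<alpha> - \<gamma> = N * (P - R)" and b: "\<beta> + 2 = P * R + M\<^sup>2"
    by (rule parameters_exist)
  have "\<bar>N\<bar> < \<bar>M\<bar>" by (rule power2_less_imp_less) (use MN in auto)
  then have "\<bar>N\<bar> < M" using MN by simp
  moreover have "(M + N) / 2 * P + (M - N) / 2 * R = (M * (P + R) + N * (P - R)) / 2"
    and "(M - N) / 2 * P + (M + N) / 2 * R = (M * (P + R) - N * (P - R)) / 2"
    by (auto simp: field_simps)
  moreover have "((M + N) / 2) * ((M - N) / 2) = 1"
    using MN by (simp add: field_simps power2_eq_square)
  moreover have "((M + N) / 2)\<^sup>2 + ((M - N) / 2)\<^sup>2 = M\<^sup>2 - 2"
    using MN by (simp add: field_simps power2_eq_square)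
  ultimately show ?thesis
    using x y b by (intro that[of "(M + N) / 2" "(M - N) / 2" P R]) (auto simp: field_simps)
qed

lemma product_expand:
  fixes m n t P R :: real
  assumes "m * n = 1"
  shows "(t\<^sup>2 + m * P * t + m\<^sup>2) * (t\<^sup>2 + n * R * t + n\<^sup>2) =
    t^4 + (m * P + n * R) * t^3 + (P * R + m\<^sup>2 + n\<^sup>2) * t\<^sup>2 + (n * P + m * R) * t + 1"
proof -
  have "(t\<^sup>2 + m * P * t + m\<^sup>2) * (t\<^sup>2 + n * R * t + n\<^sup>2) = t^4 + (m * P + n * R) * t^3
      + ((m * n) * (P * R) + m\<^sup>2 + n\<^sup>2) * t\<^sup>2 + (m * n) * (n * P + m * R) * t + (m * n)\<^sup>2"
    by algebra
  then show ?thesis by (simp add: assms)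
qed

section \<open>Nonnegativity of the product\<close>

text \<open>Handles (B) directly: \<open>t^4 - 2 * t\<^sup>2 + 1\<close> is a square and every
  remaining term is nonnegative.\<close>

lemma quartic_nonneg:
  fixes \<alpha> \<beta> \<gamma> t :: real
  assumes "\<alpha> \<ge> 0" "\<gamma> \<ge> 0" "\<beta> \<ge> -2" "t \<ge> 0"
  shows "t^4 + \<alpha> * t^3 + \<beta> * t\<^sup>2 + \<gamma> * t + 1 \<ge> 0"
proof -
  have "0 \<le> (t\<^sup>2 - 1)\<^sup>2 + \<alpha> * t^3 + (\<beta> + 2) * t\<^sup>2 + \<gamma> * t" using assms by simp
  also have "\<dots> = t^4 + \<alpha> * t^3 + \<beta> * t\<^sup>2 + \<gamma> * t + 1" by algebra
  finally show ?thesis .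
qed

lemma quadratic_nonneg:
  fixes m t P :: real
  assumes "m > 0" "t > 0" "P \<ge> -2"
  shows "t\<^sup>2 + m * P * t + m\<^sup>2 \<ge> 0"
proof -
  have "0 \<le> (t - m)\<^sup>2 + m * (P + 2) * t" using assms by simp
  then show ?thesis by (simp add: power2_eq_square algebra_simps)
qed

lemma quadratic_roots:
  fixes m P :: real
  assumes "m > 0" "P \<le> -2"
  obtains u v where "0 < u" "u \<le> v" "P < -2 \<Longrightarrow> u < v" "u + v = - m * P" "u * v = m\<^sup>2"
    "\<And>t. t\<^sup>2 + m * P * t + m\<^sup>2 = (t - u) * (t - v)"
proof -
  define D where "D = sqrt (P\<^sup>2 - 4)"
  have "2\<^sup>2 \<le> (-P)\<^sup>2" by (rule power_mono) (use assms in auto)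
  then have D2: "D\<^sup>2 = P\<^sup>2 - 4" and D0: "D \<ge> 0" by (auto simp: D_def)
  have "D < -P" by (rule power2_less_imp_less) (use D2 assms in auto)
  have Dpos: "D > 0" if "P < -2"
  proof -
    have "2\<^sup>2 < (-P)\<^sup>2" by (rule power_strict_mono) (use that in auto)
    then show ?thesis by (simp add: D_def)
  qed
  define u v where "u = m * (-P - D) / 2" and "v = m * (-P + D) / 2"
  have s: "u + v = - m * P" by (simp add: u_def v_def field_simps)
  have p: "u * v = m\<^sup>2"
  proof -
    have "u * v = m\<^sup>2 * (P\<^sup>2 - D\<^sup>2) / 4"
      by (simp add: u_def v_def field_simps power2_eq_square)
    then show ?thesis by (simp add: D2)
  qed
  have vu: "v - u = m * D" by (simp add: u_def v_def field_simps)
  show ?thesis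
  proof (rule that[of u v])
    show "0 < u" using assms \<open>D < -P\<close> by (simp add: u_def)
    have "0 \<le> m * D" using D0 assms by simp
    then show "u \<le> v" using vu by linarith
    show "u < v" if "P < -2"
    proof -
      have "0 < m * D" using Dpos[OF that] assms by simp
      then show ?thesis using vu by linarith
    qed
    show "t\<^sup>2 + m * P * t + m\<^sup>2 = (t - u) * (t - v)" for t
    proof -
      have "(t - u) * (t - v) = t\<^sup>2 - (u + v) * t + u * v"
        by (simp add: power2_eq_square algebra_simps)
      then show ?thesis unfolding s p by simp
    qed
  qed (fact s p)+
qed

text \<open>Strictly between \<open>u\<close> and \<open>v\<close> the first quadratic is negative,
  so the second must be nonpositive there; density carries the bounds to the endpoints.\<close>

lemma root_interval_subset:
  fixes u v u' v' :: real
  assumes "0 < u" "u < v" "u' \<le> v'"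
    and nonneg: "\<And>t. t > 0 \<Longrightarrow> (t - u) * (t - v) * ((t - u') * (t - v')) \<ge> 0"
  shows "u' \<le> u \<and> v \<le> v'"
proof -
  have between: "u' \<le> t \<and> t \<le> v'" if "u < t" "t < v" for t
  proof -
    have "(t - u) * (t - v) < 0" using that by (simp add: mult_pos_neg)
    with nonneg[of t] that assms(1) have "(t - u') * (t - v') \<le> 0"
      by (simp add: zero_le_mult_iff)
    with assms(3) show ?thesis by (auto simp: mult_le_0_iff)
  qed
  have "u' \<le> u" by (rule dense_ge_bounded[OF assms(2)]) (use between in auto)
  moreover have "v \<le> v'" by (rule dense_le_bounded[OF assms(2)]) (use between in auto)
  ultimately show ?thesis by simp
qed

text \<open>If \<open>P > -2\<close>, the first factor is positive at \<open>t = n\<close>, where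
  the second is \<open>n\<^sup>2 * (R + 2) < 0\<close>. Otherwise both factors have positive roots
  and their root intervals contain each other; equal roots mean equal factors.\<close>

lemma nonneg_product_imp_eq:
  fixes m n P R :: real
  assumes "m > 0" "n > 0" "R < -2"
    and nonneg: "\<And>t. t > 0 \<Longrightarrow> (t\<^sup>2 + m * P * t + m\<^sup>2) * (t\<^sup>2 + n * R * t + n\<^sup>2) \<ge> 0"
  shows "m = n \<and> P = R"
proof (cases "P \<le> -2")
  case False
  have "n\<^sup>2 + n * R * n + n\<^sup>2 = n\<^sup>2 * (R + 2)" by (simp add: power2_eq_square algebra_simps)
  then have neg: "n\<^sup>2 + n * R * n + n\<^sup>2 < 0" using assms by (simp add: mult_pos_neg)
  have "n\<^sup>2 + m * P * n + m\<^sup>2 = (n - m)\<^sup>2 + m * (P + 2) * n"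
    by (simp add: power2_eq_square algebra_simps)
  also have "\<dots> > 0" using assms False by (intro add_nonneg_pos) auto
  finally have "(n\<^sup>2 + m * P * n + m\<^sup>2) * (n\<^sup>2 + n * R * n + n\<^sup>2) < 0"
    using neg by (rule mult_pos_neg)
  with nonneg[of n] assms show ?thesis by simp
next
  case True
  obtain u v where uv: "0 < u" "u < v" "u + v = - n * R" "u * v = n\<^sup>2"
    and f: "\<And>t. t\<^sup>2 + n * R * t + n\<^sup>2 = (t - u) * (t - v)"
    using quadratic_roots[OF \<open>n > 0\<close>, of R] assms(3) by (metis less_imp_le)
  obtain u' v' where uv': "0 < u'" "u' \<le> v'" "u' + v' = - m * P" "u' * v' = m\<^sup>2"
    and f': "\<And>t. t\<^sup>2 + m * P * t + m\<^sup>2 = (t - u') * (t - v')"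
    using quadratic_roots[OF \<open>m > 0\<close> True] by metis
  have nonneg': "(t - u') * (t - v') * ((t - u) * (t - v)) \<ge> 0" if "t > 0" for t
    using nonneg[OF that] unfolding f f' .
  then have "u' \<le> u \<and> v \<le> v'"
    by (intro root_interval_subset) (use uv uv' in \<open>simp_all add: mult.commute\<close>)
  \<comment> \<open>The first inclusion gives \<open>u' < v'\<close>, so the interval lemma also
    applies with the roles exchanged.\<close>
  moreover from this have "u \<le> u' \<and> v' \<le> v"
    by (intro root_interval_subset) (use uv uv' nonneg' in auto)
  ultimately have "u' = u" "v' = v" by auto
  with uv uv' have "n\<^sup>2 = m\<^sup>2" "n * R = m * P" by auto
  then show ?thesis using assms(1,2) by (simp add: power2_eq_iff_nonneg)
qed

lemma nonneg_product_iff: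
  fixes m n P R :: real
  assumes "m > 0" "n > 0"
  shows "(\<forall>t>0. (t\<^sup>2 + m * P * t + m\<^sup>2) * (t\<^sup>2 + n * R * t + n\<^sup>2) \<ge> 0) \<longleftrightarrow>
    (P \<ge> -2 \<and> R \<ge> -2) \<or> (m = n \<and> P = R)" (is "?L \<longleftrightarrow> ?R")
proof
  assume L: ?L
  then have "R < -2 \<Longrightarrow> m = n \<and> P = R"
    using nonneg_product_imp_eq[OF assms] by blast
  moreover from L have "P < -2 \<Longrightarrow> n = m \<and> R = P"
    using nonneg_product_imp_eq[OF assms(2,1), of P R] by (simp add: mult.commute)
  ultimately show ?R by linarith
next
  assume ?R
  then show ?L
  proof
    assume "P \<ge> -2 \<and> R \<ge> -2"
    then show ?L using assms by (blast intro: mult_nonneg_nonneg quadratic_nonneg)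
  qed auto
qed

section \<open>The discriminant and the three conditions\<close>

text \<open>The resultant is written with \<open>w = (m + n)\<^sup>2\<close>, so that \<open>m\<^sup>2 + n\<^sup>2 = w - 2\<close>.\<close>

definition res :: "real \<Rightarrow> real \<Rightarrow> real \<Rightarrow> real" where
  "res w P R = w * (w - 4) + (P - R)\<^sup>2 - (w - 4) * (P * R)"

text \<open>Completes the square in \<open>R\<close>, exhibiting the resultant as a sum of
  nonnegative terms when \<open>w >= 4\<close> and \<open>|P| <= 2\<close>.\<close>

lemma res_complete_square:
  "4 * res w P R = (2 * R - (w - 2) * P)\<^sup>2 + w * (w - 4) * (4 - P\<^sup>2)"
  by (simp add: res_def power2_eq_square algebra_simps)

lemma res_commute: "res w P R = res w R P"
  by (simp add: res_def power2_commute mult.commute)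

text \<open>The discriminant of a product is the product of the discriminants times the squared
  resultant; the factors \<open>m\<^sup>2\<close> and \<open>n\<^sup>2\<close> cancel as
  \<open>m * n = 1\<close>. The left side depends on \<alpha> and \<gamma> only through
  \<open>\<alpha> * \<gamma>\<close> and \<open>\<alpha>\<^sup>2 + \<gamma>\<^sup>2\<close>, which
  the hypotheses determine.\<close>

lemma discriminant_factored:
  fixes \<alpha> \<beta> \<gamma> w P R :: real
  assumes "(\<alpha> + \<gamma>)\<^sup>2 = w * (P + R)\<^sup>2" "(\<alpha> - \<gamma>)\<^sup>2 = (w - 4) * (P - R)\<^sup>2"
    "\<beta> = P * R + w - 2"
  shows "4 * (\<beta>^2 - 3 * \<alpha> * \<gamma> + 12)^3
       - (72 * \<beta> + 9 * \<alpha> * \<beta> * \<gamma> - 2 * \<beta>^3 - 27 * \<alpha>^2 - 27 * \<gamma>^2)^2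
     = 27 * ((P\<^sup>2 - 4) * (R\<^sup>2 - 4)) * (res w P R)\<^sup>2"
proof -
  define S T where "S = \<alpha> * \<gamma>" and "T = \<alpha>\<^sup>2 + \<gamma>\<^sup>2"
  have "4 * S = w * (P + R)\<^sup>2 - (w - 4) * (P - R)\<^sup>2"
    unfolding assms(1,2)[symmetric] S_def by (simp add: power2_eq_square algebra_simps)
  then have S: "S = w * (P * R) + (P - R)\<^sup>2" by (simp add: power2_eq_square algebra_simps)
  have "2 * T = w * (P + R)\<^sup>2 + (w - 4) * (P - R)\<^sup>2"
    unfolding assms(1,2)[symmetric] T_def by (simp add: power2_eq_square algebra_simps)
  then have T: "T = w * (P\<^sup>2 + R\<^sup>2) - 2 * (P - R)\<^sup>2"
    by (simp add: power2_eq_square algebra_simps)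
  have "4 * (\<beta>^2 - 3 * \<alpha> * \<gamma> + 12)^3
       - (72 * \<beta> + 9 * \<alpha> * \<beta> * \<gamma> - 2 * \<beta>^3 - 27 * \<alpha>^2 - 27 * \<gamma>^2)^2
     = 4 * (\<beta>^2 - 3 * S + 12)^3 - (72 * \<beta> + 9 * \<beta> * S - 2 * \<beta>^3 - 27 * T)^2"
    by (simp add: S_def T_def mult_ac algebra_simps)
  also have "\<dots> = 27 * ((P\<^sup>2 - 4) * (R\<^sup>2 - 4)) * (res w P R)\<^sup>2"
  proof -
    \<comment> \<open>Everything is symmetric in \<open>P\<close> and \<open>R\<close>, so the
      identity reduces to one in \<open>k\<close>, \<open>q\<close> and \<open>w\<close>.\<close>
    define k q where "k = P * R" and "q = (P - R)\<^sup>2"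
    have sum: "P\<^sup>2 + R\<^sup>2 = q + 2 * k"
      by (simp add: k_def q_def power2_eq_square algebra_simps)
    have prod: "(P\<^sup>2 - 4) * (R\<^sup>2 - 4) = k\<^sup>2 - 4 * (q + 2 * k) + 16"
      by (simp add: k_def q_def power2_eq_square algebra_simps)
    show ?thesis
      unfolding S T assms(3) res_def prod sum k_def[symmetric] q_def[symmetric]
      by (simp add: power2_eq_square power3_eq_cube algebra_simps)
  qed
  finally show ?thesis .
qed

lemma abs_le_4_sqrt_iff:
  assumes "s \<ge> 0"
  shows "\<bar>y\<bar> \<le> 4 * sqrt s \<longleftrightarrow> y\<^sup>2 \<le> 16 * s"
proof -
  have "\<bar>y\<bar> \<le> 4 * sqrt s \<longleftrightarrow> \<bar>y\<bar> \<le> \<bar>4 * sqrt s\<bar>" using assms by simp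
  also have "\<dots> \<longleftrightarrow> y\<^sup>2 \<le> (4 * sqrt s)\<^sup>2" by (rule abs_le_square_iff)
  finally show ?thesis using assms by (simp add: power_mult_distrib)
qed

text \<open>This is the bound in (C)(ii), squared. With \<open>k = P * R\<close> it reads
  \<open>w * (16 - (P + R)\<^sup>2) >= 16 * (4 - k)\<close>; expanding
  \<open>(4 - P\<^sup>2) * (4 - R\<^sup>2) >= 0\<close> bounds the left factor below, and
  \<open>w > 8 - k\<close>.\<close>

lemma both_small_sum_bound:
  fixes w P R :: real
  assumes P: "\<bar>P\<bar> \<le> 2" and R: "\<bar>R\<bar> \<le> 2" and w: "P * R + w > 8"
  shows "w * (P + R)\<^sup>2 \<le> 16 * (P * R + w - 4)"
proof -
  define k where "k = P * R"
  have "\<bar>P\<bar> * \<bar>R\<bar> \<le> 2 * 2" by (rule mult_mono) (use P R in auto)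
  then have k: "\<bar>k\<bar> \<le> 4" by (simp add: k_def abs_mult)
  have sq: "P\<^sup>2 \<le> 2\<^sup>2" "R\<^sup>2 \<le> 2\<^sup>2" using P R abs_le_square_iff[of P 2] abs_le_square_iff[of R 2] by auto
  then have "0 \<le> (4 - P\<^sup>2) * (4 - R\<^sup>2)" by (intro mult_nonneg_nonneg) auto
  then have key: "16 - (P + R)\<^sup>2 \<ge> (4 - k) * (12 + k) / 4"
    by (simp add: k_def power2_eq_square field_simps)
  \<comment> \<open>Uses \<open>(8 - k) * (12 + k) - 64 = (4 - k) * (k + 8)\<close>.\<close>
  have "0 \<le> (4 - k) * ((4 - k) * (k + 8))"
    using k by (intro mult_nonneg_nonneg) auto
  then have "16 * (4 - k) \<le> (8 - k) * ((4 - k) * (12 + k) / 4)"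
    by (simp add: power2_eq_square algebra_simps)
  also have "\<dots> \<le> w * ((4 - k) * (12 + k) / 4)"
    using k w by (intro mult_right_mono) (auto simp: k_def)
  also have "\<dots> \<le> w * (16 - (P + R)\<^sup>2)"
    using key k w by (intro mult_left_mono) (auto simp: k_def)
  finally show ?thesis by (simp add: k_def algebra_simps)
qed

lemma res_pos_of_mid:
  fixes w P R :: real
  assumes "w \<ge> 4" "\<bar>P\<bar> < 2" "\<not> (w = 4 \<and> P = R)"
  shows "res w P R > 0"
proof -
  have "P\<^sup>2 < 2\<^sup>2" using assms(2) abs_square_less_1[of "P / 2"] by (simp add: power_divide)
  then have P: "4 - P\<^sup>2 > 0" by simp
  have "(2 * R - (w - 2) * P)\<^sup>2 + w * (w - 4) * (4 - P\<^sup>2) > 0"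
  proof (cases "w = 4")
    case True
    with assms show ?thesis by simp
  next
    case False
    with assms P show ?thesis by (intro add_nonneg_pos mult_pos_pos) auto
  qed
  then show ?thesis using res_complete_square[of w P R] by linarith
qed

text \<open>Excludes a parameter below -2 under (A). The hypotheses force \<open>P > 2\<close>, and
  \<open>P * R < 0\<close> makes every term of the resultant nonnegative, with
  \<open>(P - R)\<^sup>2\<close> positive.\<close>

lemma disc_pos_of_mixed:
  fixes w P R :: real
  assumes "w \<ge> 4" "R < -2" "P + R > 0"
  shows "(P\<^sup>2 - 4) * (R\<^sup>2 - 4) * (res w P R)\<^sup>2 > 0"
proof -
  have "2\<^sup>2 < P\<^sup>2" "2\<^sup>2 < (-R)\<^sup>2" by (rule power_strict_mono; use assms in simp)+
  moreover have "P * R < 0" using assms by (intro mult_pos_neg) auto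
  then have "(w - 4) * (P * R) \<le> 0"
    using assms(1) mult_nonneg_nonpos[of "w - 4" "P * R"] by linarith
  moreover have "w * (w - 4) \<ge> 0" "(P - R)\<^sup>2 > 0" using assms by auto
  then have "res w P R > 0" using calculation unfolding res_def by linarith
  ultimately show ?thesis by simp
qed

text \<open>Excludes a parameter below -2 under (C), apart from equal factors. The position of
  \<open>P\<close> decides which hypothesis breaks: \<open>disc\<close> for \<open>|P| < 2\<close>,
  \<open>diff\<close> for \<open>P >= 2\<close>, \<open>sum\<close> for
  \<open>P <= -2\<close>.\<close>

lemma bounds_fail_if_below:
  fixes w P R :: real
  assumes w: "w \<ge> 4" and R: "R < -2" and ne: "\<not> (w = 4 \<and> P = R)"
    and disc: "(P\<^sup>2 - 4) * (R\<^sup>2 - 4) * (res w P R)\<^sup>2 \<ge> 0"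
    and diff: "(w - 4) * (P - R)\<^sup>2 \<le> 16 * (P * R + w)"
    and sum: "P + R < 0 \<Longrightarrow> P * R + w > 8 \<Longrightarrow> w * (P + R)\<^sup>2 \<le> 16 * (P * R + w - 4)"
  shows False
proof -
  consider (mid) "\<bar>P\<bar> < 2" | (pos) "P \<ge> 2" | (neg) "P \<le> -2" by linarith
  then show False
  proof cases
    case mid
    have "P\<^sup>2 < 2\<^sup>2" using mid abs_square_less_1[of "P / 2"] by (simp add: power_divide)
    moreover have "2\<^sup>2 < (-R)\<^sup>2" by (rule power_strict_mono) (use R in auto)
    ultimately have "(P\<^sup>2 - 4) * (R\<^sup>2 - 4) < 0" by (simp add: mult_neg_pos)
    moreover have "(res w P R)\<^sup>2 > 0" using res_pos_of_mid[OF w mid ne] by simp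
    ultimately have "(P\<^sup>2 - 4) * (R\<^sup>2 - 4) * (res w P R)\<^sup>2 < 0" by (rule mult_neg_pos)
    with disc show False by simp
  next
    case pos
    have "P * R \<le> 2 * R" using pos R by (intro mult_right_mono_neg) auto
    then have PR: "P * R < -4" using R by linarith
    have "4\<^sup>2 \<le> (P - R)\<^sup>2" by (rule power_mono) (use pos R in auto)
    then have "(w - 4) * 16 \<le> (w - 4) * (P - R)\<^sup>2" using w by (intro mult_left_mono) auto
    with diff PR show False by simp
  next
    case neg
    have "2 * (-R) \<le> (-P) * (-R)" using neg R by (intro mult_right_mono) auto
    then have PR: "P * R > 4" using R by simp
    have b: "w * (P + R)\<^sup>2 \<le> 16 * (P * R + w - 4)"
      using sum neg R PR w by auto
    \<comment> \<open>Both terms on the right are nonnegative, so \<open>sum\<close> can hold only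
      if both vanish, that is, for \<open>w = 4\<close> and \<open>P = R\<close>.\<close>
    have e: "w * (P + R)\<^sup>2 - 16 * (P * R + w - 4) = w * (P - R)\<^sup>2 + 4 * ((w - 4) * (P * R - 4))"
      by (simp add: power2_eq_square algebra_simps)
    have z: "w * (P - R)\<^sup>2 \<ge> 0" "(w - 4) * (P * R - 4) \<ge> 0" using w PR by auto
    with b e have "w * (P - R)\<^sup>2 = 0" "(w - 4) * (P * R - 4) = 0" by linarith+
    with w PR ne show False by auto
  qed
qed

text \<open>Forward, the sizes of \<open>P\<close> and \<open>R\<close> select the condition: both
  at least 2 give (B), exactly one above 2 gives (A), both in [-2, 2] or a repeated factor with
  \<open>P < -2\<close> give (C). Backward, (A) and (C) exclude parameters below -2 by the preceding
  lemmas, and (B) gives nonnegativity of the quartic itself.\<close>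

lemma nonneg_criterion:
  fixes \<alpha> \<beta> \<gamma> \<Delta> m n P R w :: real
  assumes m: "m > 0" and n: "n > 0" and mn: "m * n = 1"
    and \<alpha>: "\<alpha> = m * P + n * R" and \<gamma>: "\<gamma> = n * P + m * R" and \<beta>: "\<beta> = P * R + w - 2"
    and w: "w = (m + n)\<^sup>2"
    and \<Delta>: "\<Delta> = 27 * ((P\<^sup>2 - 4) * (R\<^sup>2 - 4)) * (res w P R)\<^sup>2"
  shows "(P \<ge> -2 \<and> R \<ge> -2) \<or> (m = n \<and> P = R) \<longleftrightarrow>
      (\<Delta> \<le> 0 \<and> \<alpha> + \<gamma> > 0)
    \<or> (\<alpha> \<ge> 0 \<and> \<gamma> \<ge> 0 \<and> \<beta> \<ge> -2)
    \<or> (\<Delta> \<ge> 0 \<and> \<bar>\<alpha> - \<gamma>\<bar> \<le> 4 * sqrt (\<beta> + 2) \<and>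
        ((-2 \<le> \<beta> \<and> \<beta> \<le> 6) \<or> (\<beta> > 6 \<and> \<alpha> + \<gamma> \<ge> -4 * sqrt (\<beta> - 2))))"
    (is "?nonneg \<longleftrightarrow> ?A \<or> ?B \<or> ?C")
proof -
  have w4: "w - 4 = (m - n)\<^sup>2" using mn by (simp add: w power2_eq_square algebra_simps)
  then have wge: "w \<ge> 4" by (metis diff_ge_0_iff_ge zero_le_power2)
  have x: "\<alpha> + \<gamma> = (m + n) * (P + R)" and y: "\<alpha> - \<gamma> = (m - n) * (P - R)"
    by (simp_all add: \<alpha> \<gamma> algebra_simps)
  have x2: "(\<alpha> + \<gamma>)\<^sup>2 = w * (P + R)\<^sup>2" and y2: "(\<alpha> - \<gamma>)\<^sup>2 = (w - 4) * (P - R)\<^sup>2"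
    by (simp_all add: x y w w4[unfolded w] power_mult_distrib)
  have sq: "4 \<le> Q\<^sup>2" if "2 \<le> \<bar>Q\<bar>" for Q :: real
    using that abs_le_square_iff[of 2 Q] by simp
  have sq': "Q\<^sup>2 \<le> 4" if "\<bar>Q\<bar> \<le> 2" for Q :: real
    using that abs_le_square_iff[of Q 2] by simp
  \<comment> \<open>Condition (C) with the square roots squared away; \<open>\<beta> >= -2\<close>
    is implied by either of its two ranges.\<close>
  have C_eq: "?C \<longleftrightarrow> \<Delta> \<ge> 0 \<and> \<beta> \<ge> -2 \<and> (\<alpha> - \<gamma>)\<^sup>2 \<le> 16 * (\<beta> + 2) \<and>
      (\<beta> > 6 \<longrightarrow> \<alpha> + \<gamma> < 0 \<longrightarrow> (\<alpha> + \<gamma>)\<^sup>2 \<le> 16 * (\<beta> - 2))"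
  proof (cases "\<beta> \<ge> -2")
    case True
    have "\<alpha> + \<gamma> \<ge> -4 * sqrt (\<beta> - 2) \<longleftrightarrow> (\<alpha> + \<gamma> < 0 \<longrightarrow> (\<alpha> + \<gamma>)\<^sup>2 \<le> 16 * (\<beta> - 2))"
      if "\<beta> > 6"
    proof (cases "\<alpha> + \<gamma> < 0")
      case True
      with abs_le_4_sqrt_iff[of "\<beta> - 2" "\<alpha> + \<gamma>"] that show ?thesis by auto
    next
      case False
      have "sqrt (\<beta> - 2) \<ge> 0" using that by simp
      with False show ?thesis by linarith
    qed
    with True abs_le_4_sqrt_iff[of "\<beta> + 2" "\<alpha> - \<gamma>"] show ?thesis by auto
  qed auto
  show ?thesis
  proof
    assume ?nonneg
    then consider (large) "P \<ge> -2" "R \<ge> -2" "P + R > 0" "P > 2 \<or> R > 2"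
      | (small) "\<bar>P\<bar> \<le> 2" "\<bar>R\<bar> \<le> 2" | (square) "m = n" "P = R" "P < -2"
      by argo
    then show "?A \<or> ?B \<or> ?C"
    proof cases
      case large
      show ?thesis
      proof (cases "P \<ge> 2 \<and> R \<ge> 2")
        case True
        then show ?thesis using m n wge by (simp add: \<alpha> \<gamma> \<beta>)
      next
        case False
        with large have "\<bar>P\<bar> \<le> 2 \<and> 2 \<le> \<bar>R\<bar> \<or> 2 \<le> \<bar>P\<bar> \<and> \<bar>R\<bar> \<le> 2" by linarith
        then have "P\<^sup>2 \<le> 4 \<and> 4 \<le> R\<^sup>2 \<or> 4 \<le> P\<^sup>2 \<and> R\<^sup>2 \<le> 4" using sq sq' by blast
        then have "(P\<^sup>2 - 4) * (R\<^sup>2 - 4) \<le> 0" by (auto simp: mult_le_0_iff)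
        then have "\<Delta> \<le> 0"
          unfolding \<Delta> by (intro mult_nonpos_nonneg[OF _ zero_le_power2]) linarith
        then show ?thesis using large m n by (simp add: x)
      qed
    next
      case small
      have "(P\<^sup>2 - 4) * (R\<^sup>2 - 4) \<ge> 0"
        using sq'[OF small(1)] sq'[OF small(2)] by (intro mult_nonpos_nonpos) auto
      then have "\<Delta> \<ge> 0" by (simp add: \<Delta>)
      have "\<bar>P\<bar> * \<bar>R\<bar> \<le> 2 * 2" by (rule mult_mono) (use small in auto)
      then have PR: "\<bar>P * R\<bar> \<le> 4" by (simp add: abs_mult)
      have "(P - R)\<^sup>2 \<le> 4\<^sup>2"
        using small abs_le_square_iff[of "P - R" 4] by auto
      then have "(w - 4) * (P - R)\<^sup>2 \<le> (w - 4) * 16" using wge by (intro mult_left_mono) auto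
      with PR have "(\<alpha> - \<gamma>)\<^sup>2 \<le> 16 * (\<beta> + 2)" by (simp add: y2 \<beta>)
      moreover have "(\<alpha> + \<gamma>)\<^sup>2 \<le> 16 * (\<beta> - 2)" if "\<beta> > 6"
        using both_small_sum_bound[OF small, of w] that by (simp add: x2 \<beta>)
      moreover have "\<beta> \<ge> -2" using PR wge by (simp add: \<beta>)
      ultimately show ?thesis using \<open>\<Delta> \<ge> 0\<close> C_eq by blast
    next
      case square
      then have "w = 4" using w4 by simp
      then have "\<Delta> = 0" using square by (simp add: \<Delta> res_def)
      \<comment> \<open>For a repeated factor the bound in (C)(ii) is attained with
        equality.\<close>
      moreover have "(\<alpha> - \<gamma>)\<^sup>2 = 0" "(\<alpha> + \<gamma>)\<^sup>2 = 16 * (\<beta> - 2)" "\<beta> \<ge> -2"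
        unfolding x2 y2 \<beta> using \<open>w = 4\<close> square by (simp_all add: power2_eq_square)
      ultimately show ?thesis using C_eq by auto
    qed
  next
    assume "?A \<or> ?B \<or> ?C"
    then show ?nonneg
    proof (elim disjE)
      assume A: ?A
      then have PR: "P + R > 0" using m n by (simp add: x zero_less_mult_iff)
      have "\<not> (P\<^sup>2 - 4) * (R\<^sup>2 - 4) * (res w P R)\<^sup>2 > 0"
        using A unfolding \<Delta> by linarith
      then show ?nonneg
        using PR disc_pos_of_mixed[OF wge, of R P] disc_pos_of_mixed[OF wge, of P R]
        by (simp add: res_commute[of w R P] ac_simps not_less[symmetric]) argo
    next
      assume ?B
      have "\<beta> = P * R + m\<^sup>2 + n\<^sup>2"
        using mn by (simp add: \<beta> w power2_eq_square algebra_simps)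
      then have "(t\<^sup>2 + m * P * t + m\<^sup>2) * (t\<^sup>2 + n * R * t + n\<^sup>2) \<ge> 0" if "t > 0" for t
        using \<open>?B\<close> quartic_nonneg[of \<alpha> \<gamma> \<beta> t] that by (simp add: product_expand[OF mn] \<alpha> \<gamma>)
      then show ?nonneg using nonneg_product_iff[OF m n] by blast
    next
      assume ?C
      then have C: "\<Delta> \<ge> 0" "(\<alpha> - \<gamma>)\<^sup>2 \<le> 16 * (\<beta> + 2)"
        "\<beta> > 6 \<Longrightarrow> \<alpha> + \<gamma> < 0 \<Longrightarrow> (\<alpha> + \<gamma>)\<^sup>2 \<le> 16 * (\<beta> - 2)"
        unfolding C_eq by blast+
      have disc: "(P\<^sup>2 - 4) * (R\<^sup>2 - 4) * (res w P R)\<^sup>2 \<ge> 0"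
        using C(1) unfolding \<Delta> by linarith
      have diff: "(w - 4) * (P - R)\<^sup>2 \<le> 16 * (P * R + w)"
        using C(2) by (simp add: y2 \<beta>)
      have sum: "w * (P + R)\<^sup>2 \<le> 16 * (P * R + w - 4)" if "P + R < 0" "P * R + w > 8"
        using C(3) that m n unfolding x2 \<beta> by (simp add: x mult_pos_neg)
      have "R \<ge> -2" if "\<not> (m = n \<and> P = R)"
      proof (rule ccontr)
        assume "\<not> R \<ge> -2"
        then show False
          using that w4 disc diff sum by (intro bounds_fail_if_below[OF wge, of R P]) auto
      qed
      moreover have "P \<ge> -2" if "\<not> (m = n \<and> P = R)"
      proof (rule ccontr)
        assume "\<not> P \<ge> -2"
        then show False
          using that w4 disc diff sum
          by (intro bounds_fail_if_below[OF wge, of P R])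
            (auto simp: res_commute[of w R P] power2_commute[of R P] ac_simps)
      qed
      ultimately show ?nonneg by blast
    qed
  qed
qed

theorem theorem4p2:
  fixes a b c d e \<alpha> \<beta> \<gamma> :: real and g f :: "real poly"
  assumes "g = [:e, d, c, b, a:]" and "a > 0" and "e > 0"
    and "\<alpha> = b * a powr (-3/4) * e powr (-1/4)"
    and "\<beta> = c * a powr (-1/2) * e powr (-1/2)"
    and "\<gamma> = d * a powr (-1/4) * e powr (-3/4)"
    and "f = [:1, \<gamma>, \<beta>, \<alpha>, 1:]"
  shows "(\<forall>t>0. poly f t \<ge> 0) \<longleftrightarrow>
      (Delta f \<le> 0 \<and> \<alpha> + \<gamma> > 0)
    \<or> (\<alpha> \<ge> 0 \<and> \<gamma> \<ge> 0 \<and> \<beta> \<ge> -2)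
    \<or> (Delta f \<ge> 0 \<and> \<bar>\<alpha> - \<gamma>\<bar> \<le> 4 * sqrt (\<beta> + 2) \<and>
        ((-2 \<le> \<beta> \<and> \<beta> \<le> 6) \<or> (\<beta> > 6 \<and> \<alpha> + \<gamma> \<ge> -4 * sqrt (\<beta> - 2))))"
proof -
  obtain m n P R where m: "m > 0" and n: "n > 0" and mn: "m * n = 1"
    and \<alpha>: "\<alpha> = m * P + n * R" and \<gamma>: "\<gamma> = n * P + m * R" and b: "\<beta> = P * R + m\<^sup>2 + n\<^sup>2"
    by (rule quartic_parameters)
  define w where "w = (m + n)\<^sup>2"
  have w4: "w - 4 = (m - n)\<^sup>2" and \<beta>: "\<beta> = P * R + w - 2"
    using mn b by (simp_all add: w_def power2_eq_square algebra_simps)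
  have x: "\<alpha> + \<gamma> = (m + n) * (P + R)" and y: "\<alpha> - \<gamma> = (m - n) * (P - R)"
    by (simp_all add: \<alpha> \<gamma> algebra_simps)
  have coeffs: "coeff f 3 = \<alpha>" "coeff f 2 = \<beta>" "coeff f 1 = \<gamma>"
    by (simp_all add: assms(7) numeral_3_eq_3 numeral_2_eq_2)
  have "(\<alpha> + \<gamma>)\<^sup>2 = w * (P + R)\<^sup>2" by (simp add: x w_def power_mult_distrib)
  moreover have "(\<alpha> - \<gamma>)\<^sup>2 = (w - 4) * (P - R)\<^sup>2" by (simp add: y w4 power_mult_distrib)
  ultimately have \<Delta>: "Delta f = 27 * ((P\<^sup>2 - 4) * (R\<^sup>2 - 4)) * (res w P R)\<^sup>2"
    using discriminant_factored[OF _ _ \<beta>] by (simp add: Delta_def Let_def coeffs del: One_nat_def)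
  have f: "poly f t = t^4 + \<alpha> * t^3 + \<beta> * t\<^sup>2 + \<gamma> * t + 1" for t
    by (simp add: assms(7) algebra_simps power2_eq_square power3_eq_cube power4_eq_xxxx)
  have "poly f t = (t\<^sup>2 + m * P * t + m\<^sup>2) * (t\<^sup>2 + n * R * t + n\<^sup>2)" for t
    unfolding f product_expand[OF mn] \<alpha> \<gamma> b ..
  then have iff: "(\<forall>t>0. poly f t \<ge> 0) \<longleftrightarrow> (P \<ge> -2 \<and> R \<ge> -2) \<or> (m = n \<and> P = R)"
    using nonneg_product_iff[OF m n] by simp
  show ?thesis
    unfolding iff by (rule nonneg_criterion[OF m n mn \<alpha> \<gamma> \<beta> w_def \<Delta>])
qed

end
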